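(* For each integer $r\ge 3$ let $f_{(R),r,2}(x)=1+x^2+x^{2^r+1}+x^{2^r+2}\in\mathbb{F}_2[x]$ (this is the reciprocal polynomial of $1+x+x^{2^r}+x^{2^r+2}$). Then for every $r\ge 3$ the polynomial $f_{(R),r,2}$ is robust and its order divides $4^r+2^r+1$; moreover $\displaystyle\lim_{r\to\infty}\gamma(f_{(R),r,2})=1$.
   Context: For a polynomial $f$ of degree $n$, its reciprocal polynomial is $f_{(R)}(x)=x^nf(1/x)$. For $f\in\mathbb{F}_2[x]$ with $f(0)=1$ and $\deg f\ge 1$, the order $\operatorname{ord}(f)$ is the least integer $D\ge 1$ such that $f(x)\mid 1+x^D$ in $\mathbb{F}_2[x]$. With $D=\operatorname{ord}(f)$, let $f^*(x)\in\mathbb{F}_2[x]$ be defined by $f(x)f^*(x)=1+x^D$. For $g\in\mathbb{F}_2[x]$, $\ell_1(g)$ is the number of monomials of $g$ (terms with coefficient $1$), and for $N\ge\deg g$, $\ell_{0,N}(g)$ is the number of exponents $k\in\{0,1,\dots,N\}$ for which the coefficient of $x^k$ in $g$ is $0$. Define $\gamma(f)=\ell_1(f^* )/D$. The polynomial $f$ is called robust if $\ell_1(f^* )>\ell_{0,D-1}(f^* )+1$, equivalently $\ell_1(f^* )>(D+1)/2$. *)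

theory Defs
  imports Complex_Main "HOL-Library.Z2" "HOL-Computational_Algebra.Polynomial"
begin

(* The field F_2 is the type bit. *)

(* Meaningful when coeff f 0 = 1 and degree f >= 1, in which case such a D exists. *)
definition poly_ord :: "bit poly \<Rightarrow> nat" where
  "poly_ord f = (LEAST D. 1 \<le> D \<and> f dvd 1 + monom 1 D)"

definition poly_star :: "bit poly \<Rightarrow> bit poly" where
  "poly_star f = (THE g. f * g = 1 + monom 1 (poly_ord f))"

definition ell1 :: "bit poly \<Rightarrow> nat" where
  "ell1 g = card {k. coeff g k = 1}"

definition ell0 :: "nat \<Rightarrow> bit poly \<Rightarrow> nat" where
  "ell0 N g = card {k \<in> {0..N}. coeff g k = 0}"

definition gamma :: "bit poly \<Rightarrow> real" where
  "gamma f = real (ell1 (poly_star f)) / real (poly_ord f)"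

definition robust :: "bit poly \<Rightarrow> bool" where
  "robust f \<longleftrightarrow> ell1 (poly_star f) > ell0 (poly_ord f - 1) (poly_star f) + 1"

definition fR2 :: "nat \<Rightarrow> bit poly" where
  "fR2 r = 1 + monom 1 2 + monom 1 (2 ^ r + 1) + monom 1 (2 ^ r + 2)"

end

theory Submission
  imports Defs "HOL-Real_Asymp.Real_Asymp"
begin

text \<open>
  Write \<open>q = 2^r\<close>, \<open>n = q^2 + q + 1\<close> and \<open>p = 1 + x + x^(q+1)\<close>, so that \<open>f = (1 + x) p\<close>.
  By the Frobenius map, \<open>S = (\<Prod>i<r. 1 + x^(2^i) + x^((q+1) 2^i))\<close> satisfies
  \<open>p S = 1 + x^q + x^(q^2+q)\<close>, hence \<open>G = 1 + x S\<close> satisfies \<open>p G = 1 + x^n\<close>; moreover \<open>G\<close> has at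
  most \<open>3^r + 1\<close> terms and \<open>G(1) = 0\<close>. Let \<open>G = (1 + x) F\<close>. Then \<open>f F = 1 + x^n\<close>, and with
  \<open>J = 1 + x + \<dots> + x^(n-1) = p F\<close> one gets \<open>x^(q+1) F = J + G\<close>, so \<open>F\<close> has at least
  \<open>n - 3^r - 1\<close> terms. Finally \<open>F\<close> consists of \<open>n / ord f\<close> disjoint shifted copies of \<open>f\<^sup>*\<close>.
\<close>

section \<open>Arithmetic and term counts over F_2\<close>

lemma bit_poly_add_self [simp]: "(p :: bit poly) + p = 0"
proof (rule poly_eqI)
  have "a + a = 0" for a :: bit by simp
  then show "coeff (p + p) k = coeff 0 k" for k by (simp only: coeff_add coeff_0)
qed

lemma bit_poly_add_self_left [simp]: "(p :: bit poly) + (p + s) = s"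
  by (simp flip: add.assoc)

lemma bit_poly_square_add: "((a :: bit poly) + b) * (a + b) = a * a + b * b"
  by (simp add: algebra_simps)

lemma finite_coeff_eq_1: "finite {k. coeff (g :: bit poly) k = 1}"
  by (rule finite_subset[of _ "{..degree g}"]) (auto intro: le_degree)

lemma ell1_0 [simp]: "ell1 0 = 0"
  by (simp add: ell1_def)

lemma ell1_monom [simp]: "ell1 (monom 1 m) = 1"
proof -
  have "{k. coeff (monom 1 m :: bit poly) k = 1} = {m}" by auto
  then show ?thesis by (simp add: ell1_def)
qed

lemma ell1_1 [simp]: "ell1 1 = 1"
  using ell1_monom[of 0] by simp

lemma ell1_add_le: "ell1 (a + b) \<le> ell1 a + ell1 b"
proof -
  have "ell1 (a + b) \<le> card ({k. coeff a k = 1} \<union> {k. coeff b k = 1})"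
    unfolding ell1_def
    by (rule card_mono) (auto simp: finite_coeff_eq_1)
  also have "\<dots> \<le> ell1 a + ell1 b" unfolding ell1_def by (rule card_Un_le)
  finally show ?thesis .
qed

lemma ell1_monom_mult [simp]: "ell1 (monom 1 m * g) = ell1 g"
proof -
  have "{k. coeff (monom 1 m * g) k = 1} = (\<lambda>k. k + m) ` {k. coeff g k = 1}" (is "?A = ?B")
  proof (intro equalityI subsetI)
    fix k assume "k \<in> ?A"
    then show "k \<in> ?B"
      by (intro image_eqI[of _ _ "k - m"]) (auto simp: coeff_monom_mult split: if_splits)
  qed (auto simp: coeff_monom_mult)
  then show ?thesis by (simp add: ell1_def card_image)
qed

text \<open>All terms of \<open>a\<close> lie below exponent \<open>m\<close> and all terms of the
  shifted \<open>b\<close> at or above it, so nothing cancels and subadditivity becomes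
  equality.\<close>

lemma ell1_add_shift:
  assumes "\<And>k. m \<le> k \<Longrightarrow> coeff a k = 0"
  shows "ell1 (a + monom 1 m * b) = ell1 a + ell1 b"
proof -
  have "{k. coeff (a + monom 1 m * b) k = 1}
      = {k. coeff a k = 1} \<union> {k. coeff (monom 1 m * b) k = 1}" (is "_ = ?A \<union> ?B")
    using assms by (auto simp: coeff_monom_mult not_le split: if_splits)
  moreover have "?A \<inter> ?B = {}"
    using assms by (auto simp: coeff_monom_mult split: if_splits)
  ultimately have "ell1 (a + monom 1 m * b) = ell1 a + ell1 (monom 1 m * b)"
    unfolding ell1_def by (simp add: card_Un_disjoint finite_coeff_eq_1)
  then show ?thesis by simp
qed

lemma ell1_geometric: "ell1 (\<Sum>k<n. monom 1 k) = n"
proof (induction n)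
  case (Suc n)
  have "ell1 ((\<Sum>k<n. monom 1 k) + monom 1 n * 1) = ell1 (\<Sum>k<n. monom 1 k) + ell1 1"
    by (rule ell1_add_shift) (auto simp: coeff_sum)
  with Suc show ?case by simp
qed simp

lemma ell1_repeat:
  assumes "\<And>k. D \<le> k \<Longrightarrow> coeff g k = 0"
  shows "ell1 (g * (\<Sum>i<t. monom 1 (D * i))) = t * ell1 g"
proof (induction t)
  case (Suc t)
  have "coeff (g * (\<Sum>i<t. monom 1 (D * i))) k = 0" if "D * t \<le> k" for k
  proof -
    have "coeff g (k - D * i) = 0" if "i < t" for i
    proof (rule assms)
      have "D * i + D \<le> D * t" using that by (metis Suc_leI mult_Suc_right mult_le_mono2 add.commute)
      with \<open>D * t \<le> k\<close> show "D \<le> k - D * i" by linarith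
    qed
    then show ?thesis
      by (auto simp: sum_distrib_left coeff_sum mult.commute[of g] coeff_monom_mult intro!: sum.neutral)
  qed
  then have "ell1 (g * (\<Sum>i<t. monom 1 (D * i)) + monom 1 (D * t) * g)
      = ell1 (g * (\<Sum>i<t. monom 1 (D * i))) + ell1 g"
    by (rule ell1_add_shift)
  moreover have "g * (\<Sum>i<Suc t. monom 1 (D * i))
      = g * (\<Sum>i<t. monom 1 (D * i)) + monom 1 (D * t) * g"
    by (simp only: sum.lessThan_Suc distrib_left mult.commute[of g "monom 1 (D * t)"])
  ultimately show ?case using Suc by simp
qed simp

text \<open>The sum telescopes, with signs disappearing in characteristic 2; at \<open>t = 0\<close>
  the right side is 1 + 1 = 0.\<close>

lemma geometric_bit_poly:
  "(1 + monom 1 D) * (\<Sum>i<t. monom 1 (D * i)) = (1 + monom 1 (D * t) :: bit poly)"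
proof (induction t)
  case 0
  show ?case by (simp add: one_pCons monom_0)
next
  case (Suc t)
  have "(1 + monom 1 D) * (\<Sum>i<Suc t. monom 1 (D * i))
      = (1 + monom 1 D) * (\<Sum>i<t. monom 1 (D * i)) + (1 + monom 1 D) * (monom 1 (D * t) :: bit poly)"
    by (simp only: sum.lessThan_Suc distrib_left)
  also have "\<dots> = 1 + monom 1 (D * t) + (monom 1 (D * t) + monom 1 (D * Suc t))"
    unfolding Suc by (simp only: distrib_right mult_monom mult_1_left mult_Suc_right)
  also have "\<dots> = 1 + monom 1 (D * Suc t)"
    by (simp only: add.assoc bit_poly_add_self_left)
  finally show ?case .
qed

lemma degree_one_plus_monom: "D \<ge> 1 \<Longrightarrow> degree (1 + monom 1 D :: bit poly) = D"
  by (subst degree_add_eq_right) (auto simp: degree_monom_eq)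

text \<open>Over F_2 the exponents below \<open>D\<close> split into zeros and ones, so robustness
  becomes a condition on \<open>ell1\<close> alone.\<close>

lemma ell0_eq:
  assumes "D \<ge> 1" "\<And>k. D \<le> k \<Longrightarrow> coeff g k = 0"
  shows "ell0 (D - 1) g + ell1 g = D"
proof -
  have "{k. coeff g k = 1} \<subseteq> {..<D}" using assms(2) by (auto simp: not_le[symmetric])
  then have "{..<D} = {k \<in> {0..D - 1}. coeff g k = 0} \<union> {k. coeff g k = 1}" (is "_ = ?A \<union> ?B")
    using assms(1) by auto
  moreover have "card (?A \<union> ?B) = card ?A + card ?B"
    by (rule card_Un_disjoint) (auto simp: finite_coeff_eq_1)
  ultimately show ?thesis
    unfolding ell0_def ell1_def by (metis card_lessThan)
qed

section \<open>The order and \<open>poly_star\<close>, studied through an arbitrary cofactor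
  \<open>F\<close> of \<open>f\<close> in 1 + x^n\<close>

context
  fixes f F :: "bit poly" and n :: nat
  assumes n: "n \<ge> 1" and fF: "f * F = 1 + monom 1 n" and deg: "degree f \<ge> 1"
begin

lemma poly_ord_props: "poly_ord f \<ge> 1" "f dvd 1 + monom 1 (poly_ord f)"
proof -
  have "1 \<le> n \<and> f dvd 1 + monom 1 n" using n fF by (metis dvd_triv_left)
  then have "1 \<le> poly_ord f \<and> f dvd 1 + monom 1 (poly_ord f)"
    unfolding poly_ord_def by (rule LeastI)
  then show "poly_ord f \<ge> 1" "f dvd 1 + monom 1 (poly_ord f)" by auto
qed

lemma f_nz: "f \<noteq> 0"
  using deg by auto

lemma poly_star_eq: "f * poly_star f = 1 + monom 1 (poly_ord f)"
proof -
  obtain g where "f * g = 1 + monom 1 (poly_ord f)"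
    using poly_ord_props(2) by (metis dvdE)
  then show ?thesis
    unfolding poly_star_def by (rule theI) (use f_nz \<open>f * g = _\<close> in \<open>metis mult_left_cancel\<close>)
qed

lemma degree_f_le_poly_ord: "degree f \<le> poly_ord f"
  using dvd_imp_degree_le[OF poly_ord_props(2)] degree_one_plus_monom[OF poly_ord_props(1)]
  by (metis degree_0 not_one_le_zero poly_ord_props(1))

text \<open>Degrees add, so \<open>poly_star f\<close> has degree
  \<open>poly_ord f - degree f\<close>, strictly below the order. This keeps its copies shifted by
  multiples of the order disjoint.\<close>

lemma coeff_poly_star_eq_0: "poly_ord f \<le> k \<Longrightarrow> coeff (poly_star f) k = 0"
proof (rule coeff_eq_0)
  have "poly_star f \<noteq> 0"
    using poly_star_eq degree_one_plus_monom[OF poly_ord_props(1)] poly_ord_props(1) by auto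
  then have "degree f + degree (poly_star f) = poly_ord f"
    using degree_mult_eq[OF f_nz] poly_star_eq degree_one_plus_monom[OF poly_ord_props(1)] by metis
  then show "poly_ord f \<le> k \<Longrightarrow> degree (poly_star f) < k" using deg by linarith
qed

text \<open>Division with remainder: for \<open>b = n mod D\<close>, the divisors 1 + x^n and x^b (1
  + x^(n-b)) add up to 1 + x^b, so minimality of the order forces \<open>b = 0\<close>.\<close>

lemma poly_ord_dvd: "poly_ord f dvd n"
proof -
  define D b where "D = poly_ord f" and "b = n mod D"
  have nb: "n = b + D * (n div D)" by (simp add: b_def)
  have "f dvd 1 + monom 1 (D * (n div D))"
    using poly_ord_props(2) geometric_bit_poly[of D "n div D"] unfolding D_def by (metis dvd_mult2)
  then have "f dvd monom 1 b * (1 + monom 1 (D * (n div D)))" by (rule dvd_mult)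
  moreover have "f dvd 1 + monom 1 n" using fF by (metis dvd_triv_left)
  ultimately have "f dvd (1 + monom 1 n) + monom 1 b * (1 + monom 1 (D * (n div D)))"
    by (rule dvd_add[rotated])
  also have "monom 1 b * (1 + monom 1 (D * (n div D))) = monom 1 b + monom (1 :: bit) n"
    by (simp add: distrib_left mult_monom flip: nb)
  finally have "f dvd 1 + monom 1 b" by (simp add: add_ac)
  moreover have "b < D" using poly_ord_props(1) by (simp add: b_def D_def)
  ultimately have "b = 0"
    unfolding D_def poly_ord_def using not_less_Least by (metis One_nat_def Suc_leI neq0_conv)
  then show ?thesis by (auto simp: b_def D_def)
qed

lemma ell1_cofactor: "ell1 F = (n div poly_ord f) * ell1 (poly_star f)"
proof -
  define D t where "D = poly_ord f" and "t = n div D"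
  have nt: "n = D * t" using poly_ord_dvd by (simp add: D_def t_def)
  have "f * F = f * (poly_star f * (\<Sum>i<t. monom 1 (D * i)))"
    using fF poly_star_eq geometric_bit_poly[of D t] by (simp add: nt D_def flip: mult.assoc)
  then have "F = poly_star f * (\<Sum>i<t. monom 1 (D * i))" using f_nz by simp
  then show ?thesis
    using ell1_repeat[OF coeff_poly_star_eq_0] by (simp add: D_def t_def)
qed

text \<open>Passing from \<open>poly_star f\<close> to \<open>F\<close> multiplies both term count
  and length by \<open>n div poly_ord f\<close>, so the density is available without knowing the
  exact order.\<close>

lemma gamma_eq: "gamma f = real (ell1 F) / real n"
proof -
  obtain t where t: "n = poly_ord f * t" using poly_ord_dvd by (elim dvdE)
  then show ?thesis using ell1_cofactor n poly_ord_props(1) by (simp add: gamma_def)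
qed

lemma gamma_le_1: "gamma f \<le> 1"
  using ell0_eq[OF poly_ord_props(1) coeff_poly_star_eq_0]
  by (auto simp: gamma_def divide_le_eq_1)

text \<open>Robustness says D + 1 < 2 \<open>ell1 (poly_star f)\<close>; multiplied by t = n / D it
  reads n + t < 2 \<open>ell1 F\<close>. The unknown t is at most \<open>n div degree f\<close>,
  since D is at least \<open>degree f\<close>.\<close>

lemma robustI:
  assumes "2 * ell1 F > n + n div degree f"
  shows "robust f"
proof -
  define D t where "D = poly_ord f" and "t = n div D"
  have nt: "n = t * D" using poly_ord_dvd by (simp add: D_def t_def)
  have "t \<le> n div degree f"
    unfolding t_def D_def using degree_f_le_poly_ord deg by (intro div_le_mono2) auto
  then have "t * (D + 1) < t * (2 * ell1 (poly_star f))"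
    using assms ell1_cofactor unfolding D_def[symmetric] t_def[symmetric]
    by (simp only: nt distrib_left mult.left_commute[of 2])
  then have "D + 1 < 2 * ell1 (poly_star f)" by (simp only: mult_less_cancel1)
  then show ?thesis
    using ell0_eq[OF poly_ord_props(1) coeff_poly_star_eq_0] by (simp add: robust_def D_def)
qed

end

section \<open>The Frobenius product and the sparse multiple it yields\<close>

lemma frobenius_prod:
  fixes m :: nat
  shows "(1 + monom 1 1 + monom 1 m) * (\<Prod>i<r. 1 + monom 1 (2 ^ i) + monom 1 (m * 2 ^ i))
    = (1 + monom 1 (2 ^ r) + monom 1 (m * 2 ^ r) :: bit poly)"
proof (induction r)
  case (Suc r)
  let ?w = "1 + monom 1 (2 ^ r) + monom 1 (m * 2 ^ r) :: bit poly"
  \<comment> \<open>The new factor, at \<open>i = r\<close>, is the trinomial \<open>?w\<close> that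
    the induction hypothesis gives for the product so far, so the step is a squaring, which acts
    termwise in characteristic 2.\<close>
  have "(1 + monom 1 1 + monom 1 m) * (\<Prod>i<Suc r. 1 + monom 1 (2 ^ i) + monom 1 (m * 2 ^ i))
      = ?w * ?w"
    using Suc by (simp add: mult.assoc[symmetric])
  also have "\<dots> = 1 + monom 1 (2 ^ Suc r) + monom 1 (m * 2 ^ Suc r)"
    by (simp only: bit_poly_square_add mult_monom mult_1_left)
      (simp only: power_Suc mult_2 distrib_left)
  finally show ?case .
qed simp

text \<open>Each trinomial factor replaces the product by a sum of three shifted copies, at most
  tripling the count.\<close>

lemma ell1_frobenius_prod_le:
  "ell1 (\<Prod>i<r. 1 + monom 1 (a i) + monom 1 (b i)) \<le> 3 ^ r"
proof (induction r)
  case (Suc r)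
  define P :: "bit poly" where "P = (\<Prod>i<r. 1 + monom 1 (a i) + monom 1 (b i))"
  have "ell1 (P + monom 1 (a r) * P + monom 1 (b r) * P)
      \<le> ell1 P + ell1 (monom 1 (a r) * P) + ell1 (monom 1 (b r) * P)"
    using ell1_add_le by (meson add_le_mono1 le_trans)
  also have "\<dots> \<le> 3 ^ Suc r" using Suc by (simp add: P_def)
  finally show ?case by (simp add: P_def algebra_simps)
qed simp

lemma fR2_factor: "fR2 r = (1 + monom 1 1) * (1 + monom 1 1 + monom 1 (2 ^ r + 1))"
proof -
  have "1 + (2 ^ r + 1) = 2 ^ r + (2::nat)" "1 + 1 = (2::nat)" by simp_all
  then show ?thesis
    by (simp only: fR2_def distrib_left distrib_right mult_monom mult_1_left mult_1_right)
      (simp only: add_ac bit_poly_add_self_left)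
qed

lemma fR2_cofactor:
  obtains F where "fR2 r * F = 1 + monom 1 (4 ^ r + 2 ^ r + 1)"
    and "ell1 F + 3 ^ r \<ge> 4 ^ r + 2 ^ r"
proof -
  define q n :: nat where "q = 2 ^ r" and "n = 4 ^ r + 2 ^ r + 1"
  define p where "p = (1 + monom 1 1 + monom 1 (q + 1) :: bit poly)"
  define S where "S = (\<Prod>i<r. 1 + monom 1 (2 ^ i) + monom 1 ((q + 1) * 2 ^ i) :: bit poly)"
  define G where "G = 1 + monom 1 1 * S"
  define J where "J = (\<Sum>k<n. monom 1 k :: bit poly)"
  have qq: "q * q = 4 ^ r" by (simp add: q_def flip: power_mult_distrib)
  have "p * S = 1 + monom 1 q + monom 1 ((q + 1) * q)"
    unfolding p_def S_def using frobenius_prod[of "q + 1" r] by (simp only: q_def)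
  \<comment> \<open>Since x p S = x + x^(q+1) + x^n, its first two terms cancel against those of
    \<open>p\<close>, leaving 1 + x^n.\<close>
  moreover have "p * G = p + monom 1 1 * (p * S)"
    by (simp add: G_def algebra_simps)
  ultimately have pG: "p * G = 1 + monom 1 n"
    by (simp add: p_def n_def distrib_left mult_monom qq add_ac flip: q_def)
  \<comment> \<open>Each factor of \<open>S\<close> takes the value 1 + 1 + 1 = 1 at 1, so
    \<open>G\<close> vanishes there; as -1 = 1 in F_2, this makes 1 + x a divisor of
    \<open>G\<close>.\<close>
  have "poly S 1 = 1"
    by (simp add: S_def poly_prod poly_monom)
  then have "poly G (- 1) = 0" by (simp add: G_def poly_monom)
  then have "[:1, 1:] dvd G" by (simp add: poly_eq_0_iff_dvd)
  moreover have "[:1, 1:] = (1 + monom 1 1 :: bit poly)"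
    by (simp add: monom_Suc monom_0 one_pCons)
  ultimately obtain F where F: "G = (1 + monom 1 1) * F" by (metis dvdE)
  have "(1 + monom 1 1) * J = 1 + monom 1 n"
    using geometric_bit_poly[of 1 n] by (simp add: J_def)
  also have "\<dots> = (1 + monom 1 1) * (p * F)"
    by (simp only: pG[symmetric] F mult_ac)
  finally have "J = p * F"
    using degree_one_plus_monom[of 1] by (metis degree_0 mult_left_cancel order_refl zero_neq_one)
  \<comment> \<open>\<open>p\<close> and 1 + x differ by exactly x^(q+1), and their products with
    \<open>F\<close> are \<open>J\<close> and \<open>G\<close>.\<close>
  then have "monom 1 (q + 1) * F = J + G"
    by (simp add: F p_def distrib_left distrib_right add_ac)
  then have "ell1 F = ell1 (J + G)" by (metis ell1_monom_mult)
  \<comment> \<open>A reverse triangle inequality: \<open>J = (J + G) + G\<close> in characteristic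
    2, and \<open>J\<close> has \<open>n\<close> terms.\<close>
  moreover have "n \<le> ell1 (J + G) + ell1 G"
    using ell1_add_le[of "J + G" G] ell1_geometric[of n] by (simp add: add.assoc J_def)
  moreover have "ell1 G \<le> 1 + 3 ^ r"
    using ell1_add_le[of 1 "monom 1 1 * S"] ell1_frobenius_prod_le[of "\<lambda>i. 2 ^ i" "\<lambda>i. (q + 1) * 2 ^ i" r]
    by (simp add: G_def S_def)
  ultimately have "ell1 F + 3 ^ r \<ge> 4 ^ r + 2 ^ r" by (simp add: n_def)
  moreover have "fR2 r * F = 1 + monom 1 n"
    by (simp only: fR2_factor q_def[symmetric] p_def[symmetric] pG[symmetric] F mult_ac)
  ultimately show ?thesis using that by (simp add: n_def)
qed

section \<open>Degree, reciprocal and the final estimates\<close>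

lemma degree_four_terms:
  assumes "a < c" "b < c"
  shows "degree (1 + monom 1 a + monom 1 b + monom 1 c :: bit poly) = c"
proof -
  have "degree (1 + monom 1 a + monom 1 b :: bit poly) < degree (monom (1 :: bit) c)"
    using assms by (intro degree_add_less) (simp_all add: degree_monom_eq)
  then show ?thesis by (simp add: degree_add_eq_right degree_monom_eq)
qed

lemma reflect_four_terms:
  assumes "0 < a" "a < b" "b < c"
  shows "reflect_poly (1 + monom 1 a + monom 1 b + monom 1 c :: bit poly)
    = 1 + monom 1 (c - b) + monom 1 (c - a) + monom 1 c" (is "reflect_poly ?h = ?g")
proof (rule poly_eqI)
  fix k
  have d: "degree ?h = c" using assms by (intro degree_four_terms) auto
  show "coeff (reflect_poly ?h) k = coeff ?g k"
  proof (cases "k \<in> {0, c - b, c - a, c}")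
    case True
    then show ?thesis
      unfolding coeff_reflect_poly d using assms by (elim insertE) auto
  next
    case False
    \<comment> \<open>The guard matters: for k > c, truncated subtraction gives
      \<open>c - k = 0\<close>, which is an exponent of \<open>?h\<close>.\<close>
    then have "k \<le> c \<Longrightarrow> c - k \<noteq> 0 \<and> c - k \<noteq> a \<and> c - k \<noteq> b \<and> c - k \<noteq> c"
      using assms by auto
    with False show ?thesis
      unfolding coeff_reflect_poly d by (cases "k \<le> c") auto
  qed
qed

lemma degree_fR2: "degree (fR2 r) = 2 ^ r + 2"
  unfolding fR2_def by (rule degree_four_terms) simp_all

lemma fR2_eq_reflect_poly:
  assumes "r \<ge> 1"
  shows "fR2 r = reflect_poly (1 + monom 1 1 + monom 1 (2 ^ r) + monom 1 (2 ^ r + 2))"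
proof -
  have "1 < (2 ^ r :: nat)" using assms by (intro one_less_power) auto
  then show ?thesis by (subst reflect_four_terms) (simp_all add: fR2_def)
qed

text \<open>This is where the threshold 3 comes from: 55 < 64 at r = 3, while 19 > 16 at r =
  2.\<close>

lemma two_three_pow_less: "(r::nat) \<ge> 3 \<Longrightarrow> 2 * 3 ^ r + 1 < (4 ^ r :: nat)"
  by (induction r rule: dec_induct) auto

theorem mainTheorem4:
  shows "(\<forall>r\<ge>3.
            fR2 r = reflect_poly (1 + monom 1 1 + monom 1 (2 ^ r) + monom 1 (2 ^ r + 2)) \<and>
            robust (fR2 r) \<and>
            poly_ord (fR2 r) dvd 4 ^ r + 2 ^ r + 1)
         \<and> (\<lambda>r. gamma (fR2 r)) \<longlonglongrightarrow> 1"
proof (intro conjI allI impI)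
  fix r :: nat
  obtain F where F: "fR2 r * F = 1 + monom 1 (4 ^ r + 2 ^ r + 1)" "ell1 F + 3 ^ r \<ge> 4 ^ r + 2 ^ r"
    by (rule fR2_cofactor)
  show "poly_ord (fR2 r) dvd 4 ^ r + 2 ^ r + 1"
    by (rule poly_ord_dvd[OF _ F(1)]) (auto simp: degree_fR2)
  assume r: "r \<ge> 3"
  then show "fR2 r = reflect_poly (1 + monom 1 1 + monom 1 (2 ^ r) + monom 1 (2 ^ r + 2))"
    by (intro fR2_eq_reflect_poly) simp
  have "(4::nat) ^ r = 2 ^ r * 2 ^ r" by (simp flip: power_mult_distrib)
  moreover have "(1::nat) < 2 ^ r" using r by (intro one_less_power) auto
  \<comment> \<open>With q = 2^r > 1, one has q^2 + q + 1 < q (q + 2); this bounds the number of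
    copies in \<open>robustI\<close>.\<close>
  ultimately have "(4 ^ r + 2 ^ r + 1) div (2 ^ r + 2) < (2 ^ r :: nat)"
    by (intro less_mult_imp_div_less) (auto simp: distrib_left)
  then show "robust (fR2 r)"
    using F(2) two_three_pow_less[OF r]
    by (intro robustI[OF _ F(1)]) (auto simp: degree_fR2)
next
  have "(4 ^ r + 2 ^ r - 3 ^ r) / (4 ^ r + 2 ^ r + 1) \<le> gamma (fR2 r) \<and> gamma (fR2 r) \<le> 1" for r
  proof -
    obtain F where F: "fR2 r * F = 1 + monom 1 (4 ^ r + 2 ^ r + 1)" "ell1 F + 3 ^ r \<ge> 4 ^ r + 2 ^ r"
      by (rule fR2_cofactor)
    have "real (4 ^ r + 2 ^ r) \<le> real (ell1 F + 3 ^ r)" using F(2) by (simp only: of_nat_le_iff)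
    then have "4 ^ r + 2 ^ r - 3 ^ r \<le> real (ell1 F)" by simp
    then have "(4 ^ r + 2 ^ r - 3 ^ r) / (4 ^ r + 2 ^ r + 1) \<le> real (ell1 F) / (4 ^ r + 2 ^ r + 1)"
      by (rule divide_right_mono) simp
    moreover have "gamma (fR2 r) = real (ell1 F) / real (4 ^ r + 2 ^ r + 1)"
      by (rule gamma_eq[OF _ F(1)]) (auto simp: degree_fR2)
    then have "gamma (fR2 r) = real (ell1 F) / (4 ^ r + 2 ^ r + 1)" by simp
    moreover have "gamma (fR2 r) \<le> 1"
      by (rule gamma_le_1[OF _ F(1)]) (auto simp: degree_fR2)
    ultimately show ?thesis by simp
  qed
  then have lo: "\<And>r. (4 ^ r + 2 ^ r - 3 ^ r) / (4 ^ r + 2 ^ r + 1) \<le> gamma (fR2 r)"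
    and up: "\<And>r. gamma (fR2 r) \<le> 1" by blast+
  \<comment> \<open>The lower bound of the squeeze tends to 1 because 3^r and 2^r are negligible
    against 4^r.\<close>
  have "(\<lambda>r::nat. (4 ^ r + 2 ^ r - 3 ^ r) / (4 ^ r + 2 ^ r + 1) :: real) \<longlonglongrightarrow> 1"
    by real_asymp
  then show "(\<lambda>r. gamma (fR2 r)) \<longlonglongrightarrow> 1"
    by (rule tendsto_sandwich[rotated 2, OF _ tendsto_const]) (use lo up in auto)
qed

end
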